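(* Let $A$ be a definite $n\times n$ max-plus matrix. Then the set of full-support vectors of the eigenspace of $A$, $\mathrm{eig}(A)\cap\mathbb{R}^n$ (and likewise $\mathrm{eig}(A^* )\cap\mathbb{R}^n$ for the closure $A^*$), is equal to $$X=\{x\in\mathbb{R}^n : A_{ij}\le x_i-x_j \text{ for all } i\ne j \text{ such that } A_{ij}=A^*_{ij}\}.$$
   Context: All arithmetic is written conventionally on $\mathbb{R}_{\max}=\mathbb{R}\cup\{-\infty\}$, the semiring with addition $\oplus=\max$ and multiplication $\odot=+$ (with $\alpha+(-\infty)=-\infty$); its zero is $-\infty$ and its unity is the real number $0$. A max-plus matrix is a matrix with entries in $\mathbb{R}_{\max}$; products are $(A\odot B)_{ij}=\max_k (A_{ik}+B_{kj})$, sums are entrywise maxima, and $I$ is the max-plus identity matrix ($0$ on the diagonal, $-\infty$ elsewhere). Maximal cycle mean: $\lambda(A)=\max_{\tau}\frac{1}{|K(\tau)|}\sum_{i\in K(\tau)}A_{i\tau(i)}$, where $\tau$ ranges over all cyclic permutations of nonempty subsets $K(\tau)\subseteq\{1,\dots,n\}$ (singletons included). $A$ is definite if $\lambda(A)=0$ and $A_{ii}=0$ for all $i$. Closure: $A^*=I\oplus A\oplus A^2\oplus\cdots$ (entrywise supremum of max-plus powers); it exists for definite $A$ and is again definite. For a definite matrix $A$, $\mathrm{eig}(A)=\{x\in\mathbb{R}_{\max}^n: A\odot x=x\}$. A vector has full support if all its components are real (different from $-\infty$). *)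

theory Defs
  imports
    "HOL-Analysis.Finite_Cartesian_Product"
    "HOL-Library.Extended_Real"
    "HOL-Combinatorics.Combinatorics"
begin

text \<open>The max-plus semiring is the set of extended reals different from \<open>\<infinity>\<close>, with the
  conventional arithmetic of type \<^typ>\<open>ereal\<close>. Since \<open>-\<infinity> + \<infinity> = \<infinity>\<close> there, the
  value \<open>\<infinity>\<close> has to be excluded explicitly from matrices and vectors.\<close>

definition maxplus_vec :: "ereal ^ 'n \<Rightarrow> bool" where
  "maxplus_vec x \<longleftrightarrow> (\<forall>i. x $ i \<noteq> \<infinity>)"

definition maxplus_mat :: "ereal ^ 'n ^ 'm \<Rightarrow> bool" where
  "maxplus_mat A \<longleftrightarrow> (\<forall>i j. A $ i $ j \<noteq> \<infinity>)"

definition mp_mult :: "ereal ^ 'n ^ 'm \<Rightarrow> ereal ^ 'p ^ 'n \<Rightarrow> ereal ^ 'p ^ 'm" (infixl \<open>\<otimes>\<close> 70) where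
  "A \<otimes> B = (\<chi> i j. MAX k. A $ i $ k + B $ k $ j)"

definition mp_mult_vec :: "ereal ^ 'n ^ 'm \<Rightarrow> ereal ^ 'n \<Rightarrow> ereal ^ 'm" (infixl \<open>\<otimes>v\<close> 70) where
  "A \<otimes>v x = (\<chi> i. MAX k. A $ i $ k + x $ k)"

definition mp_id :: "ereal ^ 'n ^ 'n" where
  "mp_id = (\<chi> i j. if i = j then 0 else -\<infinity>)"

fun mp_power :: "ereal ^ 'n ^ 'n \<Rightarrow> nat \<Rightarrow> ereal ^ 'n ^ 'n" where
  "mp_power A 0 = mp_id"
| "mp_power A (Suc k) = A \<otimes> mp_power A k"

text \<open>The supremum is taken in \<^typ>\<open>ereal\<close>, so it is a supremum in the max-plus semiring
  exactly when it is not \<open>\<infinity>\<close>; this is the case for definite matrices.\<close>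

definition closure_mat :: "ereal ^ 'n ^ 'n \<Rightarrow> ereal ^ 'n ^ 'n" where
  "closure_mat A = (\<chi> i j. SUP k. mp_power A k $ i $ j)"

text \<open>Singletons \<open>K = {i}\<close> are included, with \<open>\<tau> = id\<close>: the set
  \<open>orbit id i\<close> is \<open>{i}\<close>, hence \<open>cyclic_on id {i}\<close>.\<close>

definition max_cycle_mean :: "ereal ^ 'n ^ 'n \<Rightarrow> ereal" where
  "max_cycle_mean A =
     Max {(\<Sum>i\<in>K. A $ i $ \<tau> i) / ereal (real (card K)) |K \<tau>.
            K \<noteq> {} \<and> \<tau> permutes K \<and> cyclic_on \<tau> K}"

definition definite :: "ereal ^ 'n ^ 'n \<Rightarrow> bool" where
  "definite A \<longleftrightarrow> maxplus_mat A \<and> max_cycle_mean A = 0 \<and> (\<forall>i. A $ i $ i = 0)"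

definition eig :: "ereal ^ 'n ^ 'n \<Rightarrow> (ereal ^ 'n) set" where
  "eig A = {x. maxplus_vec x \<and> A \<otimes>v x = x}"

text \<open>The copy of real n-space inside the max-plus vectors.\<close>

definition full_support :: "(ereal ^ 'n) set" where
  "full_support = {x. \<forall>i. \<bar>x $ i\<bar> \<noteq> \<infinity>}"

definition saturated_ineqs :: "ereal ^ 'n ^ 'n \<Rightarrow> (ereal ^ 'n) set" where
  "saturated_ineqs A = {x \<in> full_support.
     \<forall>i j. i \<noteq> j \<and> A $ i $ j = closure_mat A $ i $ j \<longrightarrow> A $ i $ j \<le> x $ i - x $ j}"

end

(* Powers of A are weights of walks. In a definite matrix every elementary cycle has weight at most
   0, so cycles can be cut out of a walk and each entry of the closure C is the weight of some walk.
   By the triangle inequality for C, every edge on such an optimal walk satisfies A u v = C u v if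
   its weight is finite. Hence the inequalities for these edges, summed along the walk, give
   C i j \<le> x i - x j for all i, j, which in full support means that x is an eigenvector of C
   and, since A \<le> C, of A. *)

theory Submission
  imports Defs
begin

section \<open>Weights of walks\<close>

definition walk_weight :: "('a \<Rightarrow> 'a \<Rightarrow> ereal) \<Rightarrow> 'a list \<Rightarrow> ereal" where
  "walk_weight a xs = (\<Sum>(u, v)\<leftarrow>zip xs (tl xs). a u v)"

lemma walk_weight_simps [simp]:
  "walk_weight a [] = 0"
  "walk_weight a [v] = 0"
  "walk_weight a (u # v # xs) = a u v + walk_weight a (v # xs)"
  by (simp_all add: walk_weight_def)

lemma walk_weight_not_PInf:
  assumes "\<And>i j. a i j \<noteq> \<infinity>"
  shows "walk_weight a xs \<noteq> \<infinity>"
  using assms by (induction xs rule: induct_list012) simp_all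

text \<open>The cut vertex \<open>v\<close> ends the first piece and starts the second, so every
  edge is counted exactly once.\<close>

lemma walk_weight_append:
  "walk_weight a (xs @ v # ys) = walk_weight a (xs @ [v]) + walk_weight a (v # ys)"
  by (induction xs rule: induct_list012) (simp_all add: add.assoc)

section \<open>Elementary cycles as cyclic permutations\<close>

lemma map_cycle_of_list: "distinct cs \<Longrightarrow> map (cycle_of_list cs) cs = rotate1 cs"
  using cyclic_rotation[of cs 1] by simp

lemma cyclic_on_cycle_of_list:
  assumes "distinct cs" "cs \<noteq> []"
  shows "cyclic_on (cycle_of_list cs) (set cs)"
proof (rule cyclic_on_singleI)
  show "cs ! 0 \<in> set cs"
    using assms by simp
  \<comment> \<open>Applying the cycle \<open>n\<close> times to all of \<open>cs\<close> rotates
    the list by \<open>n\<close>; this reads off its first entry.\<close>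
  have iter: "(cycle_of_list cs ^^ n) (cs ! 0) = cs ! (n mod length cs)" for n
    using cyclic_rotation[OF assms(1), of n] assms(2)
    by (metis add.right_neutral length_greater_0_conv nth_map nth_rotate)
  show "set cs = orbit (cycle_of_list cs) (cs ! 0)"
  proof
    show "set cs \<subseteq> orbit (cycle_of_list cs) (cs ! 0)"
    proof
      fix x assume "x \<in> set cs"
      then obtain n where "n < length cs" "x = cs ! n"
        by (metis in_set_conv_nth)
      then have "x = (cycle_of_list cs ^^ n) (cs ! 0)"
        by (simp add: iter)
      then show "x \<in> orbit (cycle_of_list cs) (cs ! 0)"
        by (auto simp: orbit_altdef_permutation[OF permutation_of_cycle])
    qed
    show "orbit (cycle_of_list cs) (cs ! 0) \<subseteq> set cs"
      using assms(2) by (auto simp: orbit_altdef_permutation[OF permutation_of_cycle] iter)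
  qed
qed

text \<open>Translates closed walks into the sums over permutations that occur in
  \<open>max_cycle_mean\<close>: each vertex is followed by its image under the cycle. For
  \<open>ys = []\<close> the walk is a loop and the permutation is the identity.\<close>

lemma closed_walk_weight:
  assumes "distinct (v # ys)"
  shows "walk_weight a (v # ys @ [v])
       = (\<Sum>i\<in>set (v # ys). a i (cycle_of_list (v # ys) i))"
proof -
  let ?cs = "v # ys"
  \<comment> \<open>The first list is longer by one, so its final \<open>v\<close> stays
    unpaired.\<close>
  have "zip (v # ys @ [v]) (ys @ [v]) = zip ?cs (ys @ [v])"
    using zip_append1[of ?cs "[v]" "ys @ [v]"] by simp
  also have "\<dots> = zip ?cs (map (cycle_of_list ?cs) ?cs)"
    using map_cycle_of_list[OF assms] by simp
  also have "\<dots> = map (\<lambda>i. (i, cycle_of_list ?cs i)) ?cs"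
    by (simp add: zip_map2 zip_same_conv_map del: cycle_of_list.simps)
  finally have "walk_weight a (v # ys @ [v])
      = (\<Sum>(u, w)\<leftarrow>map (\<lambda>i. (i, cycle_of_list ?cs i)) ?cs. a u w)"
    by (simp only: walk_weight_def list.sel)
  also have "\<dots> = (\<Sum>i\<leftarrow>?cs. a i (cycle_of_list ?cs i))"
    by (simp add: o_def del: cycle_of_list.simps)
  finally show ?thesis
    by (simp only: sum_list_distinct_conv_sum_set[OF assms])
qed

lemma definite_closed_walk_le_0:
  fixes A :: "ereal ^ 'n ^ 'n"
  assumes "definite A" "distinct (v # ys)"
  shows "walk_weight (\<lambda>i j. A $ i $ j) (v # ys @ [v]) \<le> 0"
proof -
  let ?M = "{(\<Sum>i\<in>K. A $ i $ \<tau> i) / ereal (real (card K)) |K \<tau>.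
            K \<noteq> {} \<and> \<tau> permutes K \<and> cyclic_on \<tau> K}"
  let ?K = "set (v # ys)" and ?\<tau> = "cycle_of_list (v # ys)"
  let ?S = "\<Sum>i\<in>?K. A $ i $ ?\<tau> i"
  \<comment> \<open>\<open>Max\<close> bounds the members only of a finite set; here the pairs
    \<open>(K, \<tau>)\<close> range over a finite type.\<close>
  have "?M \<subseteq> (\<lambda>(K, \<tau>). (\<Sum>i\<in>K. A $ i $ \<tau> i) / ereal (real (card K))) ` UNIV"
    by auto
  then have fin: "finite ?M"
    by (rule finite_subset) simp
  have "?S / ereal (real (card ?K)) \<in> ?M"
    using cycle_permutes[of "v # ys"] cyclic_on_cycle_of_list[OF assms(2)] by blast
  with fin have "?S / ereal (real (card ?K)) \<le> Max ?M"
    by (rule Max_ge)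
  also have "Max ?M = 0"
    using assms(1) by (simp only: definite_def max_cycle_mean_def)
  finally have "?S / ereal (real (card ?K)) \<le> 0" .
  moreover have "0 < ereal (real (card ?K))"
    by (simp add: card_gt_0_iff del: card.insert)
  ultimately have "?S \<le> 0"
    by (subst (asm) ereal_divide_le_pos) auto
  then show ?thesis
    by (simp only: closed_walk_weight[OF assms(2)])
qed

section \<open>Powers and the closure as maximal walk weights\<close>

lemma walk_weight_le_power:
  fixes A :: "ereal ^ 'n ^ 'n"
  shows "walk_weight (\<lambda>i j. A $ i $ j) (v # xs)
       \<le> mp_power A (length xs) $ v $ last (v # xs)"
proof (induction xs arbitrary: v)
  case Nil
  then show ?case by (simp add: mp_id_def)
next
  case (Cons u xs)
  have "A $ v $ u + walk_weight (\<lambda>i j. A $ i $ j) (u # xs)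
      \<le> A $ v $ u + mp_power A (length xs) $ u $ last (u # xs)"
    by (intro add_left_mono Cons.IH)
  \<comment> \<open>Left multiplication by \<open>A\<close> prepends an edge; the edge to
    \<open>u\<close> is one candidate.\<close>
  also have "\<dots> \<le> (MAX k. A $ v $ k + mp_power A (length xs) $ k $ last (u # xs))"
    by (intro Max_ge) auto
  finally show ?case
    by (simp add: mp_mult_def)
qed

lemma walk_weight_le_closure:
  fixes A :: "ereal ^ 'n ^ 'n"
  shows "walk_weight (\<lambda>i j. A $ i $ j) (v # xs) \<le> closure_mat A $ v $ last (v # xs)"
proof -
  have "mp_power A (length xs) $ v $ last (v # xs) \<le> (SUP k. mp_power A k $ v $ last (v # xs))"
    by (rule SUP_upper) simp
  with walk_weight_le_power[of A v xs] show ?thesis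
    unfolding closure_mat_def by (simp only: vec_lambda_beta)
qed

text \<open>An extremal walk for the power is built edge by edge, and each time a new first vertex
  closes a cycle, that cycle is removed without lowering the weight.\<close>

lemma power_le_path_weight:
  fixes A :: "ereal ^ 'n ^ 'n"
  assumes "definite A"
  shows "\<exists>xs. distinct (i # xs) \<and> last (i # xs) = j \<and>
              mp_power A k $ i $ j \<le> walk_weight (\<lambda>i j. A $ i $ j) (i # xs)"
proof (induction k arbitrary: i)
  case 0
  show ?case
  proof (cases "i = j")
    case True
    then show ?thesis
      by (intro exI[of _ "[]"]) (simp add: mp_id_def)
  next
    case False
    then show ?thesis
      \<comment> \<open>The entry of \<open>mp_id\<close> is \<open>-\<infinity>\<close>, so any
        path from \<open>i\<close> to \<open>j\<close> serves.\<close>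
      by (intro exI[of _ "[j]"]) (simp add: mp_id_def)
  qed
next
  case (Suc k)
  let ?w = "walk_weight (\<lambda>i j. A $ i $ j)"
  have "(MAX l. A $ i $ l + mp_power A k $ l $ j)
      \<in> range (\<lambda>l. A $ i $ l + mp_power A k $ l $ j)"
    by (intro Max_in) auto
  then obtain l where "(MAX l. A $ i $ l + mp_power A k $ l $ j) = A $ i $ l + mp_power A k $ l $ j"
    by (rule rangeE)
  then have l: "mp_power A (Suc k) $ i $ j = A $ i $ l + mp_power A k $ l $ j"
    by (simp add: mp_mult_def)
  obtain xs where xs: "distinct (l # xs)" "last (l # xs) = j"
      "mp_power A k $ l $ j \<le> ?w (l # xs)"
    using Suc.IH by blast
  have le: "mp_power A (Suc k) $ i $ j \<le> ?w (i # l # xs)"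
    using l xs(3) by (simp add: add_left_mono)
  show ?case
  proof (cases "i \<in> set (l # xs)")
    case False
    with xs le show ?thesis
      by (intro exI[of _ "l # xs"]) auto
  next
    case True
    then obtain ys zs where split: "l # xs = ys @ i # zs"
      by (meson split_list)
    \<comment> \<open>Since \<open>l # xs\<close> is distinct, it contains \<open>i\<close> only
      once: the cycle to be removed and the remaining path are both elementary.\<close>
    have "distinct (i # ys)" "distinct (i # zs)"
      using xs(1) unfolding split by auto
    have "?w (i # l # xs) = ?w (i # ys @ [i]) + ?w (i # zs)"
      using walk_weight_append[of _ "i # ys" i zs] by (simp add: split)
    also have "\<dots> \<le> 0 + ?w (i # zs)"
      by (intro add_right_mono definite_closed_walk_le_0 assms) fact
    finally have "mp_power A (Suc k) $ i $ j \<le> ?w (i # zs)"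
      using le by simp
    moreover have "last (i # zs) = j"
      using xs(2) by (simp add: split)
    ultimately show ?thesis
      using \<open>distinct (i # zs)\<close> by blast
  qed
qed

text \<open>Over a finite type there are only finitely many elementary paths, so the heaviest one
  from \<open>i\<close> to \<open>j\<close> bounds all powers at once.\<close>

lemma closure_attained:
  fixes A :: "ereal ^ 'n ^ 'n"
  assumes "definite A"
  obtains xs where "distinct (i # xs)" "last (i # xs) = j"
    "closure_mat A $ i $ j = walk_weight (\<lambda>i j. A $ i $ j) (i # xs)"
proof -
  let ?w = "walk_weight (\<lambda>i j. A $ i $ j)"
  let ?P = "{xs. distinct (i # xs) \<and> last (i # xs) = j}"
  have "finite {xs :: 'n list. distinct xs}"
    using finite_subset_distinct[of "UNIV :: 'n set"] by simp
  then have fin: "finite ?P"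
    by (rule rev_finite_subset) auto
  have ne: "?P \<noteq> {}"
    using power_le_path_weight[OF assms] by blast
  have "Max ((\<lambda>xs. ?w (i # xs)) ` ?P) \<in> (\<lambda>xs. ?w (i # xs)) ` ?P"
    using fin ne by (intro Max_in) auto
  then obtain xs where xs: "xs \<in> ?P" "Max ((\<lambda>xs. ?w (i # xs)) ` ?P) = ?w (i # xs)"
    by blast
  have "mp_power A k $ i $ j \<le> ?w (i # xs)" for k
  proof -
    obtain ys where "ys \<in> ?P" and ys: "mp_power A k $ i $ j \<le> ?w (i # ys)"
      using power_le_path_weight[OF assms] by blast
    then have "?w (i # ys) \<le> Max ((\<lambda>xs. ?w (i # xs)) ` ?P)"
      using fin by (intro Max_ge) auto
    with ys xs(2) show ?thesis by simp
  qed
  then have "closure_mat A $ i $ j \<le> ?w (i # xs)"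
    by (simp add: closure_mat_def SUP_least)
  moreover have "?w (i # xs) \<le> closure_mat A $ i $ j"
    using walk_weight_le_closure[of A i xs] xs(1) by simp
  ultimately have "closure_mat A $ i $ j = ?w (i # xs)"
    by (rule order_antisym)
  with xs(1) show ?thesis
    by (intro that[of xs]) auto
qed

section \<open>Bounds, diagonal and triangle inequality of the closure\<close>

lemma le_closure:
  fixes A :: "ereal ^ 'n ^ 'n"
  shows "A $ i $ j \<le> closure_mat A $ i $ j"
  using walk_weight_le_closure[of A i "[j]"] by simp

lemma closure_not_PInf:
  fixes A :: "ereal ^ 'n ^ 'n"
  assumes "definite A"
  shows "closure_mat A $ i $ j \<noteq> \<infinity>"
proof -
  obtain xs where "closure_mat A $ i $ j = walk_weight (\<lambda>i j. A $ i $ j) (i # xs)"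
    using closure_attained[OF assms] by metis
  moreover have "walk_weight (\<lambda>i j. A $ i $ j) (i # xs) \<noteq> \<infinity>"
    using assms by (intro walk_weight_not_PInf) (simp add: definite_def maxplus_mat_def)
  ultimately show ?thesis by simp
qed

lemma closure_diag:
  fixes A :: "ereal ^ 'n ^ 'n"
  assumes "definite A"
  shows "closure_mat A $ i $ i = 0"
proof -
  obtain xs where xs: "distinct (i # xs)" "last (i # xs) = i"
    "closure_mat A $ i $ i = walk_weight (\<lambda>i j. A $ i $ j) (i # xs)"
    using closure_attained[OF assms] .
  \<comment> \<open>A walk without repeated vertices that returns to its start has no edges.\<close>
  then have "xs = []"
    by (auto split: if_splits)
  with xs(3) show ?thesis by simp
qed

text \<open>Two optimal walks are concatenated at \<open>l\<close>. The result may repeat vertices,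
  but the closure bounds the weight of every walk.\<close>

lemma closure_triangle:
  fixes A :: "ereal ^ 'n ^ 'n"
  assumes "definite A"
  shows "closure_mat A $ i $ l + closure_mat A $ l $ j \<le> closure_mat A $ i $ j"
proof -
  let ?w = "walk_weight (\<lambda>i j. A $ i $ j)"
  obtain xs where xs: "last (i # xs) = l" "closure_mat A $ i $ l = ?w (i # xs)"
    using closure_attained[OF assms] .
  obtain ys where ys: "last (l # ys) = j" "closure_mat A $ l $ j = ?w (l # ys)"
    using closure_attained[OF assms] .
  have decomp: "i # xs = butlast (i # xs) @ [l]"
    using xs(1) append_butlast_last_id[of "i # xs"] by simp
  have eq: "i # xs @ ys = butlast (i # xs) @ l # ys"
    by (metis decomp append_Cons append_assoc append_Nil)
  have "?w (i # xs @ ys) = ?w (i # xs) + ?w (l # ys)"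
    by (subst eq, subst walk_weight_append, subst decomp[symmetric]) simp
  moreover have "last (i # xs @ ys) = j"
    using ys(1) by (simp only: eq) simp
  ultimately show ?thesis
    using walk_weight_le_closure[of A i "xs @ ys"] xs(2) ys(2) by simp
qed

section \<open>Optimal walks and saturated inequalities\<close>

lemma ereal_add_tight:
  fixes p q p' q' :: ereal
  assumes "p \<le> p'" "q \<le> q'" "p' + q' \<le> p + q" "p + q \<noteq> -\<infinity>" "p' \<noteq> \<infinity>" "q' \<noteq> \<infinity>"
  shows "p = p'" "q = q'"
  \<comment> \<open>The hypotheses force all four numbers to be real; with
    \<open>p = p' = -\<infinity>\<close> a strict \<open>q < q'\<close> would go unnoticed.\<close>
  using assms by (cases p; cases q; cases p'; cases q'; simp)+

text \<open>Tails of an optimal walk of finite weight are again optimal, which makes induction along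
  the walk possible.\<close>

lemma optimal_walk_le_diff:
  fixes A :: "ereal ^ 'n ^ 'n"
  assumes "definite A" "x \<in> saturated_ineqs A"
    and "walk_weight (\<lambda>i j. A $ i $ j) (u # xs) = closure_mat A $ u $ last (u # xs)"
    and "closure_mat A $ u $ last (u # xs) \<noteq> -\<infinity>"
  shows "closure_mat A $ u $ last (u # xs) \<le> x $ u - x $ last (u # xs)"
  using assms(3,4)
proof (induction xs arbitrary: u)
  case Nil
  have "\<bar>x $ u\<bar> \<noteq> \<infinity>"
    using assms(2) by (simp add: saturated_ineqs_def full_support_def)
  with closure_diag[OF assms(1)] show ?case
    by simp
next
  case (Cons v xs)
  let ?C = "\<lambda>i j. closure_mat A $ i $ j" and ?w = "walk_weight (\<lambda>i j. A $ i $ j)"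
  let ?j = "last (v # xs)"
  have C: "?C u ?j = A $ u $ v + ?w (v # xs)" "?C u ?j \<noteq> -\<infinity>"
    using Cons.prems by simp_all
  \<comment> \<open>\<open>A $ u $ v + ?w (v # xs)\<close> equals \<open>?C u ?j\<close>, hence is
    at least \<open>?C u v + ?C v ?j\<close>, although each summand is at most its
    counterpart.\<close>
  have tight: "A $ u $ v = ?C u v" "?w (v # xs) = ?C v ?j"
    using ereal_add_tight[OF le_closure walk_weight_le_closure]
      closure_triangle[OF assms(1), of u v ?j] C closure_not_PInf[OF assms(1)] by metis+
  have fin: "\<bar>x $ i\<bar> \<noteq> \<infinity>" for i
    using assms(2) by (simp add: saturated_ineqs_def full_support_def)
  have "A $ u $ v \<le> x $ u - x $ v"
  \<comment> \<open>Loops are not covered by \<open>saturated_ineqs\<close>; for them definiteness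
    gives weight 0.\<close>
  proof (cases "u = v")
    case True
    with assms(1) fin[of u] show ?thesis by (simp add: definite_def)
  next
    case False
    with assms(2) tight(1) show ?thesis by (simp add: saturated_ineqs_def)
  qed
  moreover have "?C v ?j \<noteq> -\<infinity>"
    using C tight(2) closure_not_PInf[OF assms(1), of u v] tight(1) by auto
  with Cons.IH tight(2) have "?w (v # xs) \<le> x $ v - x $ ?j"
    by metis
  ultimately have "?C u ?j \<le> (x $ u - x $ v) + (x $ v - x $ ?j)"
    unfolding C(1) by (rule add_mono)
  also have "\<dots> = x $ u - x $ ?j"
    using fin[of u] fin[of v] fin[of ?j]
    by (cases "x $ u"; cases "x $ v"; cases "x $ ?j") auto
  finally show ?case by simp
qed

lemma saturated_closure_le_diff:
  fixes A :: "ereal ^ 'n ^ 'n"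
  assumes "definite A" "x \<in> saturated_ineqs A"
  shows "closure_mat A $ i $ j \<le> x $ i - x $ j"
proof (cases "closure_mat A $ i $ j = -\<infinity>")
  case False
  obtain xs where "last (i # xs) = j"
    "closure_mat A $ i $ j = walk_weight (\<lambda>i j. A $ i $ j) (i # xs)"
    using closure_attained[OF assms(1)] .
  with optimal_walk_le_diff[OF assms, of i xs] False show ?thesis by metis
qed simp

section \<open>Full-support eigenvectors as solutions of difference inequalities\<close>

lemma eig_full_support:
  fixes M :: "ereal ^ 'n ^ 'n"
  assumes "\<And>i. M $ i $ i = 0"
  shows "eig M \<inter> full_support = {x \<in> full_support. \<forall>i j. M $ i $ j \<le> x $ i - x $ j}"
proof -
  have "x \<in> eig M \<longleftrightarrow> (\<forall>i j. M $ i $ j \<le> x $ i - x $ j)" if "x \<in> full_support" for x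
  proof -
    have fin: "\<bar>x $ i\<bar> \<noteq> \<infinity>" for i
      using that by (simp add: full_support_def)
    have "x $ i \<noteq> \<infinity>" for i
      using fin[of i] by auto
    then have "x \<in> eig M \<longleftrightarrow> (\<forall>i. (MAX k. M $ i $ k + x $ k) = x $ i)"
      by (auto simp: eig_def maxplus_vec_def mp_mult_vec_def vec_eq_iff)
    \<comment> \<open>The zero diagonal makes \<open>x $ i\<close> itself one of the terms, so the
      maximum equals it as soon as no term exceeds it.\<close>
    also have "\<dots> \<longleftrightarrow> (\<forall>i k. M $ i $ k + x $ k \<le> x $ i)"
    proof (intro all_cong1)
      fix i
      have "x $ i \<in> range (\<lambda>k. M $ i $ k + x $ k)"
        using assms by (intro range_eqI[of _ _ i]) simp
      then show "(MAX k. M $ i $ k + x $ k) = x $ i \<longleftrightarrow> (\<forall>k. M $ i $ k + x $ k \<le> x $ i)"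
        by (subst Max_eq_iff) auto
    qed
    also have "\<dots> \<longleftrightarrow> (\<forall>i j. M $ i $ j \<le> x $ i - x $ j)"
      using fin by (simp add: ereal_le_minus)
    finally show ?thesis .
  qed
  then show ?thesis by blast
qed

theorem proposition11:
  fixes A :: "ereal ^ 'n ^ 'n"
  assumes "definite A"
  shows "eig A \<inter> full_support = saturated_ineqs A \<and>
         eig (closure_mat A) \<inter> full_support = saturated_ineqs A"
proof -
  let ?E = "\<lambda>M. {x \<in> full_support. \<forall>i j. M $ i $ j \<le> x $ i - x $ j}"
  \<comment> \<open>The next three inclusions close a circle through
    \<open>?E (closure_mat A)\<close> and \<open>?E A\<close>, so all three sets coincide.\<close>
  have "saturated_ineqs A \<subseteq> ?E (closure_mat A)"
    using saturated_closure_le_diff[OF assms] by (auto simp: saturated_ineqs_def)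
  moreover have "?E (closure_mat A) \<subseteq> ?E A"
    by (auto intro: order_trans[OF le_closure])
  moreover have "?E A \<subseteq> saturated_ineqs A"
  proof
    fix x assume "x \<in> ?E A"
    then have "x \<in> full_support" "A $ i $ j \<le> x $ i - x $ j" for i j
      by simp_all
    then show "x \<in> saturated_ineqs A"
      unfolding saturated_ineqs_def by (intro CollectI conjI allI impI)
  qed
  ultimately have "?E A = saturated_ineqs A" "?E (closure_mat A) = saturated_ineqs A"
    by (meson order_trans subset_antisym)+
  moreover have "eig A \<inter> full_support = ?E A"
    using assms by (intro eig_full_support) (simp add: definite_def)
  moreover have "eig (closure_mat A) \<inter> full_support = ?E (closure_mat A)"
    using assms by (intro eig_full_support closure_diag)
  ultimately show ?thesis
    by (simp only: simp_thms)
qed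

end
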